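(* Let $\{X_n\}_{n\ge0}$ be a Harris recurrent $\psi$-irreducible Markov chain on $\mathscr{X}$. Let $\{E_n\}_{n\ge1}\subset\mathscr{B}(\mathscr{X})$ be an increasing sequence of bounded sets with $\mathscr{X}=\bigcup_{n=1}^\infty E_n$. Suppose there exist a continuous function $V:\mathscr{X}\to\mathbb{R}$, a set $A\in\mathscr{B}^+(\mathscr{X})$, a continuous function $W:\mathscr{X}\to[0,\infty)$ and a constant $d$ such that (1) $\sup_{x\in A}V(x)<\infty$ and $\sup_{x\in A^c}V(x)=\infty$; (2) $V$ is locally bounded, and $PV(x)\ge V(x)-1$ for all $x\in A^c$; (3) $PW(x)\le W(x)+d\,\mathbf{1}_A(x)$ for all $x\in\mathscr{X}$, and $\lim_{m\to\infty}\sup_{x\in E_m^c}\frac{V(x)}{W(x)}=0$. Then $\{X_n\}_{n\ge0}$ is non-strongly ergodic (i.e. not strongly ergodic).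
   Context: $\mathscr{X}$ is a locally compact separable metric space with a countably generated $\sigma$-field $\mathscr{B}(\mathscr{X})$. $\{X_n\}_{n\ge0}$ is a homogeneous Markov chain on $\mathscr{X}$ with $n$-step kernels $P^n(x,A)=\mathbb{P}(X_n\in A\mid X_0=x)$, $P=P^1$, and $Pf(x)=\int_{\mathscr{X}}f(y)P(x,\mathrm{d}y)$ for measurable $f$. The chain is $\psi$-irreducible if there is a $\sigma$-finite measure $\psi$ on $(\mathscr{X},\mathscr{B}(\mathscr{X}))$ such that $\sum_{n\ge1}P^n(x,A)>0$ for all $x\in\mathscr{X}$ whenever $\psi(A)>0$; throughout, $\psi$ is a maximal irreducibility measure (every irreducibility measure is absolutely continuous with respect to $\psi$), and $\mathscr{B}^+(\mathscr{X})=\{A\in\mathscr{B}(\mathscr{X}):\psi(A)>0\}$. A set $C\in\mathscr{B}(\mathscr{X})$ is petite if there are a probability distribution $\{a_n\}$ on $\mathbb{Z}_+$ and a non-trivial measure $\nu_a$ on $\mathscr{B}(\mathscr{X})$ with $\sum_{n\ge0}a_nP^n(x,B)\ge\nu_a(B)$ for all $x\in C$, $B\in\mathscr{B}(\mathscr{X})$. $\tau_A^+=\inf\{n\ge1:X_n\in A\}$. Harris recurrent: $\mathbb{P}_x(\sum_{n\ge1}\mathbf{1}_{\{X_n\in A\}}=\infty)=1$ for all $x\in\mathscr{X}$, $A\in\mathscr{B}^+(\mathscr{X})$. Strongly (uniformly) ergodic: there is a petite set $C\in\mathscr{B}(\mathscr{X})$ with $\sup_{x\in\mathscr{X}}\mathbb{E}_x\tau_C^+<\infty$;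 in this case $\sup_{x\in\mathscr{X}}\mathbb{E}_x\tau_A^+<\infty$ for every $A\in\mathscr{B}^+(\mathscr{X})$.
   Formalization: "V is locally bounded" is taken to mean that V is bounded on every metric-bounded subset of the space; boundedness near each point is automatic for continuous V, and with it the claim fails, e.g. on a countable space with the discrete bounded metric. *)

theory Defs
  imports "HOL-Probability.Probability"
begin

text \<open>
  A Markov chain on the state space \<open>UNIV :: 'a set\<close> with its Borel sets is given by random
  elements \<open>X n\<close> on a common measurable space \<open>\<Omega>\<close> together with the laws \<open>\<P> x\<close> on \<open>\<Omega>\<close>
  (written $\mathbb{P}_x$ in the literature) of the chain started at \<open>x\<close>.
\<close>

definition nstep :: "('a \<Rightarrow> 'w measure) \<Rightarrow> (nat \<Rightarrow> 'w \<Rightarrow> 'a::topological_space) \<Rightarrow> nat \<Rightarrow> 'a \<Rightarrow> 'a measure"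
  where "nstep \<P> X n x = distr (\<P> x) borel (X n)"

definition natural_filtration ::
    "'w measure \<Rightarrow> (nat \<Rightarrow> 'w \<Rightarrow> 'a::topological_space) \<Rightarrow> nat \<Rightarrow> 'w measure"
  where "natural_filtration \<Omega> X n =
    sigma (space \<Omega>) {X i -` B \<inter> space \<Omega> | i B. i \<le> n \<and> B \<in> sets borel}"

text \<open>
  Homogeneity is expressed by the same one-step kernel appearing at every time \<open>n\<close> in the
  Markov property.
\<close>

definition markov_chain ::
    "'w measure \<Rightarrow> ('a \<Rightarrow> 'w measure) \<Rightarrow> (nat \<Rightarrow> 'w \<Rightarrow> 'a::topological_space) \<Rightarrow> bool"
  where "markov_chain \<Omega> \<P> X \<longleftrightarrow>
    (\<forall>x. prob_space (\<P> x) \<and> sets (\<P> x) = sets \<Omega>) \<and>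
    (\<forall>n. X n \<in> \<Omega> \<rightarrow>\<^sub>M borel) \<and>
    (\<forall>x. AE \<omega> in \<P> x. X 0 \<omega> = x) \<and>
    nstep \<P> X 1 \<in> borel \<rightarrow>\<^sub>M prob_algebra borel \<and>
    (\<forall>x n. \<forall>B\<in>sets borel. AE \<omega> in \<P> x.
       real_cond_exp (\<P> x) (natural_filtration \<Omega> X n) (indicator (X (Suc n) -` B \<inter> space \<Omega>)) \<omega>
         = measure (nstep \<P> X 1 (X n \<omega>)) B)"

definition irreducibility_measure ::
    "('a \<Rightarrow> 'w measure) \<Rightarrow> (nat \<Rightarrow> 'w \<Rightarrow> 'a::topological_space) \<Rightarrow> 'a measure \<Rightarrow> bool"
  where "irreducibility_measure \<P> X \<phi> \<longleftrightarrow>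
    sigma_finite_measure \<phi> \<and> sets \<phi> = sets borel \<and>
    (\<forall>A\<in>sets borel. emeasure \<phi> A > 0 \<longrightarrow> (\<forall>x. (\<Sum>n. emeasure (nstep \<P> X (Suc n) x) A) > 0))"

definition maximal_irreducibility_measure ::
    "('a \<Rightarrow> 'w measure) \<Rightarrow> (nat \<Rightarrow> 'w \<Rightarrow> 'a::topological_space) \<Rightarrow> 'a measure \<Rightarrow> bool"
  where "maximal_irreducibility_measure \<P> X \<psi> \<longleftrightarrow>
    irreducibility_measure \<P> X \<psi> \<and>
    (\<forall>\<phi>. irreducibility_measure \<P> X \<phi> \<longrightarrow> absolutely_continuous \<psi> \<phi>)"

definition positive_sets :: "'a::topological_space measure \<Rightarrow> 'a set set"
  where "positive_sets \<psi> = {A \<in> sets borel. emeasure \<psi> A > 0}"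

definition petite ::
    "('a \<Rightarrow> 'w measure) \<Rightarrow> (nat \<Rightarrow> 'w \<Rightarrow> 'a::topological_space) \<Rightarrow> 'a set \<Rightarrow> bool"
  where "petite \<P> X C \<longleftrightarrow> C \<in> sets borel \<and>
    (\<exists>(a :: nat pmf) \<nu>. sets \<nu> = sets borel \<and> emeasure \<nu> UNIV > 0 \<and>
       (\<forall>x\<in>C. \<forall>B\<in>sets borel.
          (\<Sum>n. ennreal (pmf a n) * emeasure (nstep \<P> X n x) B) \<ge> emeasure \<nu> B))"

text \<open>The infimum of the empty set of \<^typ>\<open>enat\<close> is \<open>\<infinity>\<close>.\<close>

definition return_time :: "(nat \<Rightarrow> 'w \<Rightarrow> 'a) \<Rightarrow> 'a set \<Rightarrow> 'w \<Rightarrow> enat"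
  where "return_time X A \<omega> = (INF n\<in>{n. 1 \<le> n \<and> X n \<omega> \<in> A}. enat n)"

definition harris_recurrent ::
    "('a \<Rightarrow> 'w measure) \<Rightarrow> (nat \<Rightarrow> 'w \<Rightarrow> 'a::topological_space) \<Rightarrow> 'a measure \<Rightarrow> bool"
  where "harris_recurrent \<P> X \<psi> \<longleftrightarrow>
    (\<forall>x. \<forall>A\<in>positive_sets \<psi>.
       measure (\<P> x) {\<omega>\<in>space (\<P> x). (\<Sum>n. indicator A (X (Suc n) \<omega>)) = (\<infinity>::ennreal)} = 1)"

definition strongly_ergodic ::
    "('a \<Rightarrow> 'w measure) \<Rightarrow> (nat \<Rightarrow> 'w \<Rightarrow> 'a::topological_space) \<Rightarrow> bool"
  where "strongly_ergodic \<P> X \<longleftrightarrow>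
    (\<exists>C. petite \<P> X C \<and>
       (SUP x. \<integral>\<^sup>+ \<omega>. ennreal_of_enat (return_time X C \<omega>) \<partial>\<P> x) < \<infinity>)"

text \<open>
  ``Locally bounded'' means bounded on every bounded subset of the metric space. For a continuous
  function the weaker notion (bounded near every point) would be automatic, and it would not
  suffice for the theorem when bounded sets fail to be relatively compact.
\<close>

definition locally_bounded :: "('a::metric_space \<Rightarrow> real) \<Rightarrow> bool"
  where "locally_bounded V \<longleftrightarrow> (\<forall>S. bounded S \<longrightarrow> bounded (V ` S))"

end

theory Submission
  imports Defs
begin

text \<open>
  Under strong ergodicity the expected hitting time of \<open>A\<close> is bounded by some \<open>M\<close>, uniformly in the
  starting point: from anywhere the petite set is reached within boundedly many steps with
  probability bounded below, and by irreducibility and minorization the same holds from the petite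
  set to \<open>A\<close>, so the probability of avoiding \<open>A\<close> decays geometrically.

  On the other hand, let \<open>V \<le> c\<close> on \<open>A\<close>. For \<open>\<epsilon> > 0\<close> the growth condition gives a constant
  \<open>b \<ge> c\<close> with \<open>H = b + \<epsilon> W - V \<ge> 0\<close>. Off \<open>A\<close> we have \<open>P H \<le> H + 1\<close>, while \<open>H \<ge> b - c\<close> on \<open>A\<close>, so
  running the chain until it hits \<open>A\<close> yields \<open>b - c \<le> H x + M\<close>, that is
  \<open>V x \<le> c + M + \<epsilon> W x\<close>. Letting \<open>\<epsilon> \<rightarrow> 0\<close> bounds \<open>V\<close> off \<open>A\<close>, a contradiction. Working with the
  nonnegative \<open>H\<close> avoids any integrability question for the stopped process \<open>V (X (n \<and> \<tau>))\<close>.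
\<close>

section \<open>Transition operator and survival probabilities\<close>

definition kernel_op :: "('a \<Rightarrow> 'a measure) \<Rightarrow> ('a \<Rightarrow> ennreal) \<Rightarrow> 'a \<Rightarrow> ennreal"
  where "kernel_op K f x = (\<integral>\<^sup>+y. f y \<partial>K x)"

text \<open>\<open>survival K A n x\<close> is the probability that none of \<open>X 1, \<dots>, X n\<close> lies in \<open>A\<close>; the starting
  point \<open>x\<close> itself may lie in \<open>A\<close>.\<close>

primrec survival :: "('a \<Rightarrow> 'a measure) \<Rightarrow> 'a set \<Rightarrow> nat \<Rightarrow> 'a \<Rightarrow> ennreal"
  where
    "survival K A 0 x = 1"
  | "survival K A (Suc n) x = kernel_op K (\<lambda>y. indicator (- A) y * survival K A n y) x"

locale borel_kernel =
  fixes K :: "'a::topological_space \<Rightarrow> 'a measure"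
  assumes kernel: "K \<in> borel \<rightarrow>\<^sub>M prob_algebra borel"
begin

lemma sets_kernel [measurable_cong, simp]: "sets (K x) = sets borel"
  using measurable_space[OF kernel, of x] by (simp add: space_prob_algebra)

lemma space_kernel [simp]: "space (K x) = UNIV"
  using sets_eq_imp_space_eq[OF sets_kernel[of x]] by simp

lemma prob_space_kernel: "prob_space (K x)"
  using measurable_space[OF kernel, of x] by (simp add: space_prob_algebra)

lemma measurable_kernel_op [measurable]:
  assumes "f \<in> borel_measurable borel"
  shows "kernel_op K f \<in> borel_measurable borel"
  unfolding kernel_op_def
  using measurable_compose[OF measurable_prob_algebraD[OF kernel]
      nn_integral_measurable_subprob_algebra[OF assms]] by simp

lemma measurable_kernel_op_funpow [measurable]:
  assumes "f \<in> borel_measurable borel"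
  shows "(kernel_op K ^^ n) f \<in> borel_measurable borel"
  by (induction n) (auto simp: assms)

lemma kernel_op_const [simp]: "kernel_op K (\<lambda>_. c) x = c"
  using prob_space.emeasure_space_1[OF prob_space_kernel[of x]] by (simp add: kernel_op_def)

lemma kernel_op_mono: "(\<And>y. f y \<le> g y) \<Longrightarrow> kernel_op K f x \<le> kernel_op K g x"
  unfolding kernel_op_def by (rule nn_integral_mono)

lemma kernel_op_add:
  assumes [measurable]: "f \<in> borel_measurable borel" "g \<in> borel_measurable borel"
  shows "kernel_op K (\<lambda>y. f y + g y) x = kernel_op K f x + kernel_op K g x"
  unfolding kernel_op_def by (rule nn_integral_add) simp_all

lemma kernel_op_cmult:
  assumes [measurable]: "f \<in> borel_measurable borel"
  shows "kernel_op K (\<lambda>y. c * f y) x = c * kernel_op K f x"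
  unfolding kernel_op_def by (rule nn_integral_cmult) simp

lemma kernel_op_sum:
  assumes "\<And>i. f i \<in> borel_measurable borel"
  shows "kernel_op K (\<lambda>y. \<Sum>i\<in>I. f i y) x = (\<Sum>i\<in>I. kernel_op K (f i) x)"
  unfolding kernel_op_def using assms by (subst nn_integral_sum) (auto simp: measurable_def)

lemma measurable_survival [measurable]:
  assumes [measurable]: "A \<in> sets borel"
  shows "survival K A n \<in> borel_measurable borel"
proof (induction n)
  case 0
  then show ?case by (simp add: fun_eq_iff cong: measurable_cong)
next
  case (Suc n)
  note [measurable] = Suc
  show ?case by simp
qed

lemma survival_le_1: "survival K A n x \<le> 1"
proof (induction n arbitrary: x)
  case (Suc n)
  have "kernel_op K (\<lambda>y. indicator (- A) y * survival K A n y) x \<le> kernel_op K (\<lambda>_. 1) x"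
    using Suc by (intro kernel_op_mono) (auto simp: indicator_def)
  then show ?case by simp
qed simp

lemma survival_Suc_le: "survival K A (Suc n) x \<le> survival K A n x"
proof (induction n arbitrary: x)
  case 0
  then show ?case using survival_le_1[of A "Suc 0" x] by simp
next
  case (Suc n)
  have "kernel_op K (\<lambda>y. indicator (- A) y * survival K A (Suc n) y) x
      \<le> kernel_op K (\<lambda>y. indicator (- A) y * survival K A n y) x"
    by (intro kernel_op_mono mult_left_mono Suc zero_le)
  then show ?case by simp
qed

lemma survival_antimono: "m \<le> n \<Longrightarrow> survival K A n x \<le> survival K A m x"
  using lift_Suc_antimono_le[of "\<lambda>n. survival K A n x"] survival_Suc_le by blast

section \<open>Upper bounds on survival probabilities\<close>

text \<open>The chain runs freely for \<open>k\<close> steps, then \<open>le\<close> applies at the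
  state reached. Ignoring visits to \<open>A\<close> during these steps only enlarges the survival
  probability. Sums bounded by 1 replace complements, so nothing is subtracted in
  \<open>ennreal\<close>.\<close>

lemma funpow_kernel_op_add_survival_le_1:
  assumes [measurable]: "f \<in> borel_measurable borel" "A \<in> sets borel"
    and le: "\<And>y. f y + survival K A N y \<le> 1"
  shows "(kernel_op K ^^ k) f x + survival K A (N + k) x \<le> 1"
proof (induction k arbitrary: x)
  case 0
  then show ?case using le by simp
next
  case (Suc k)
  have "survival K A (N + Suc k) x \<le> kernel_op K (survival K A (N + k)) x"
    by (simp, intro kernel_op_mono) (auto simp: indicator_def)
  then have "(kernel_op K ^^ Suc k) f x + survival K A (N + Suc k) x
      \<le> kernel_op K ((kernel_op K ^^ k) f) x + kernel_op K (survival K A (N + k)) x"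
    by (simp only: funpow.simps o_apply add_left_mono)
  also have "\<dots> = kernel_op K (\<lambda>y. (kernel_op K ^^ k) f y + survival K A (N + k) y) x"
    by (rule kernel_op_add[symmetric]) simp_all
  also have "\<dots> \<le> kernel_op K (\<lambda>_. 1) x"
    by (intro kernel_op_mono Suc)
  finally show ?case by simp
qed

text \<open>Being in \<open>A\<close> at time \<open>k + 1\<close> and avoiding \<open>A\<close> at
  all times from 1 to \<open>k + 1\<close> are disjoint events. The case of one step is the
  splitting of 1 into the indicators of \<open>A\<close> and its complement.\<close>

lemma funpow_indicator_add_survival_le_1:
  assumes [measurable]: "A \<in> sets borel"
  shows "(kernel_op K ^^ Suc k) (indicator A) x + survival K A (Suc k) x \<le> 1"
proof -
  have "kernel_op K (indicator A) y + survival K A 1 y \<le> 1" for y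
  proof -
    have "kernel_op K (indicator A) y + survival K A 1 y
        = kernel_op K (\<lambda>y. indicator A y + indicator (- A) y) y"
      by (simp add: kernel_op_add)
    also have "\<dots> = kernel_op K (\<lambda>_. 1) y"
      by (rule arg_cong2[where f = "kernel_op K"]) (auto simp: indicator_def fun_eq_iff)
    finally show ?thesis by simp
  qed
  then have "(kernel_op K ^^ k) (kernel_op K (indicator A)) x + survival K A (1 + k) x \<le> 1"
    by (intro funpow_kernel_op_add_survival_le_1) simp_all
  then show ?thesis by (simp add: funpow_swap1)
qed

text \<open>Once in \<open>C\<close> at time \<open>k\<close>, the chain hits \<open>A\<close>
  within \<open>N\<close> further steps with chance at least \<delta>. The horizon
  \<open>N + L\<close> serves all \<open>k \<le> L\<close> at once, because survival decreases in
  time.\<close>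

lemma survival_le_1_via_set:
  assumes [measurable]: "A \<in> sets borel" "C \<in> sets borel"
    and C: "\<And>y. y \<in> C \<Longrightarrow> \<delta> + survival K A N y \<le> 1"
    and k: "k \<le> L"
  shows "\<delta> * (kernel_op K ^^ k) (indicator C) x + survival K A (N + L) x \<le> 1"
proof -
  have *: "(kernel_op K ^^ k) (\<lambda>y. \<delta> * indicator C y)
      = (\<lambda>x. \<delta> * (kernel_op K ^^ k) (indicator C) x)"
    by (induction k) (auto simp: kernel_op_cmult)
  have "(kernel_op K ^^ k) (\<lambda>y. \<delta> * indicator C y) x + survival K A (N + k) x \<le> 1"
    using C survival_le_1[of A N]
    by (intro funpow_kernel_op_add_survival_le_1) (auto simp: indicator_def)
  moreover have "survival K A (N + L) x \<le> survival K A (N + k) x"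
    using k by (intro survival_antimono) simp
  ultimately show ?thesis
    unfolding * using add_left_mono order_trans by blast
qed

text \<open>Every block of \<open>N\<close> steps costs a fraction \<delta> of the surviving mass.
  Summing these losses telescopes up to the first \<open>N\<close> survival probabilities, each at
  most 1, so no geometric series has to be evaluated.\<close>

lemma suminf_survival_le:
  assumes A[measurable]: "A \<in> sets borel"
    and \<delta>: "\<And>y. \<delta> + survival K A N y \<le> 1"
  shows "\<delta> * (\<Sum>n. survival K A n x) \<le> of_nat N"
proof -
  have step: "\<delta> * survival K A m y + survival K A (N + m) y \<le> survival K A m y" for m y
  proof (induction m arbitrary: y)
    case 0
    then show ?case using \<delta> by simp
  next
    case (Suc m)
    have "\<delta> * survival K A (Suc m) y + survival K A (N + Suc m) y
       = kernel_op K (\<lambda>y. \<delta> * (indicator (- A) y * survival K A m y)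
           + indicator (- A) y * survival K A (N + m) y) y"
      by (simp add: kernel_op_add kernel_op_cmult)
    also have "\<dots> \<le> survival K A (Suc m) y"
      using Suc by (simp, intro kernel_op_mono) (auto simp: indicator_def)
    finally show ?case .
  qed
  define S where "S n = (\<Sum>m<n. survival K A m x)" for n
  have S_le: "S n \<le> of_nat n" for n
    using sum_mono[of "{..<n}" "\<lambda>m. survival K A m x" "\<lambda>_. 1"] survival_le_1
    by (simp add: S_def)
  have "\<delta> * S n \<le> of_nat N" for n
  proof -
    have split: "S (N + n) = S N + (\<Sum>m<n. survival K A (N + m) x)" for n
      by (induction n) (simp_all add: S_def add.assoc)
    have "\<delta> * S n + (\<Sum>m<n. survival K A (N + m) x) \<le> S n"
      unfolding S_def sum_distrib_left sum.distrib[symmetric] by (intro sum_mono step)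
    then have "\<delta> * S n + S (N + n) \<le> S N + S n"
      unfolding split by (metis add.left_commute add_left_mono)
    moreover have "S n \<le> S (N + n)"
      unfolding S_def by (intro sum_mono2) auto
    ultimately have "S n + \<delta> * S n \<le> S n + S N"
      by (metis add.commute add_left_mono order_trans)
    \<comment> \<open>Cancelling \<open>S n\<close> in \<open>ennreal\<close> requires it to be
      finite; this is why partial sums are bounded before passing to the series.\<close>
    moreover have "S n \<noteq> \<top>"
      using S_le[of n] by (metis ennreal_of_nat_neq_top neq_top_trans)
    ultimately have "\<delta> * S n \<le> S N"
      by (simp add: ennreal_add_left_cancel_le)
    then show ?thesis using S_le order_trans by blast
  qed
  then show ?thesis
    unfolding suminf_eq_SUP SUP_mult_left_ennreal S_def by (intro SUP_least)
qed

section \<open>The drift inequality up to the hitting time\<close>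

text \<open>This is optional stopping at the minimum of \<open>n\<close> and the hitting time, done
  by first-step induction. The survival sum is the expected number of steps, each costing at most 1.
  The last term compensates the paths still outside \<open>A\<close> at time \<open>n\<close>, where
  only nonnegativity of \<open>H\<close> is known.\<close>

lemma drift_lower_bound:
  assumes [measurable]: "A \<in> sets borel" "H \<in> borel_measurable borel"
    and A: "\<And>y. y \<in> A \<Longrightarrow> b \<le> H y"
    and drift: "\<And>y. y \<notin> A \<Longrightarrow> kernel_op K H y \<le> H y + 1"
    and x: "x \<notin> A"
  shows "b \<le> H x + (\<Sum>k<n. survival K A k x) + b * survival K A n x"
  using x
proof (induction n arbitrary: x)
  case 0
  then show ?case by simp
next
  case (Suc n)
  let ?g = "\<lambda>k y. indicator (- A) y * survival K A k y"
  have "b = kernel_op K (\<lambda>_. b) x" by simp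
  \<comment> \<open>On \<open>A\<close> the indicators vanish and \<open>b \<le> H y\<close>
    suffices; off \<open>A\<close> the integrand is the induction hypothesis.\<close>
  also have "\<dots> \<le> kernel_op K (\<lambda>y. H y + ((\<Sum>k<n. ?g k y) + b * ?g n y)) x"
    using A Suc.IH by (intro kernel_op_mono) (auto simp: indicator_def add.assoc)
  also have "\<dots> = kernel_op K H x
      + ((\<Sum>k<n. survival K A (Suc k) x) + b * survival K A (Suc n) x)"
  proof -
    have "kernel_op K (\<lambda>y. \<Sum>k<n. ?g k y) x = (\<Sum>k<n. survival K A (Suc k) x)"
      by (subst kernel_op_sum) simp_all
    moreover have "kernel_op K (\<lambda>y. b * ?g n y) x = b * survival K A (Suc n) x"
      by (subst kernel_op_cmult) simp_all
    ultimately show ?thesis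
      by (subst kernel_op_add, simp, simp, subst kernel_op_add) simp_all
  qed
  also have "\<dots> \<le> (H x + 1) + ((\<Sum>k<n. survival K A (Suc k) x) + b * survival K A (Suc n) x)"
    by (intro add_right_mono drift Suc.prems)
  also have "\<dots> = H x + (\<Sum>k<Suc n. survival K A k x) + b * survival K A (Suc n) x"
    by (simp only: sum.lessThan_Suc_shift survival.simps(1) add.assoc)
  finally show ?case .
qed

text \<open>A convergent survival series has terms tending to 0, so the compensating term, with its
  finite factor \<open>b\<close>, disappears as \<open>n\<close> grows.\<close>

lemma drift_lower_bound_suminf:
  assumes A: "A \<in> sets borel" "H \<in> borel_measurable borel"
    "\<And>y. y \<in> A \<Longrightarrow> b \<le> H y" "\<And>y. y \<notin> A \<Longrightarrow> kernel_op K H y \<le> H y + 1" "x \<notin> A"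
    and b: "b < \<top>" and fin: "(\<Sum>k. survival K A k x) < \<top>"
  shows "b \<le> H x + (\<Sum>k. survival K A k x)"
proof -
  let ?g = "\<lambda>k. survival K A k x"
  have g: "?g \<longlonglongrightarrow> 0"
  proof -
    have eq: "?g k = ennreal (enn2real (?g k))" for k
      using survival_le_1[of A k x]
      by (metis ennreal_enn2real ennreal_one_less_top le_less_trans)
    have "summable (\<lambda>k. enn2real (?g k))"
      using fin eq by (intro summable_suminf_not_top) auto
    then have "(\<lambda>k. ennreal (enn2real (?g k))) \<longlonglongrightarrow> ennreal 0"
      by (intro tendsto_ennrealI summable_LIMSEQ_zero)
    then show ?thesis by (simp flip: eq)
  qed
  have "(\<lambda>n. H x + (\<Sum>k. ?g k) + b * ?g n) \<longlonglongrightarrow> H x + (\<Sum>k. ?g k) + b * 0"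
    using b by (intro tendsto_add tendsto_const ennreal_tendsto_cmult g)
  moreover have "b \<le> H x + (\<Sum>k. ?g k) + b * ?g n" for n
    using drift_lower_bound[OF A, of n] sum_le_suminf[of ?g "{..<n}"]
    by (meson add_left_mono add_right_mono finite_lessThan order_trans summableI zero_le)
  ultimately show ?thesis
    using LIMSEQ_le_const by fastforce
qed

end

section \<open>From path laws to iterates of the one-step kernel\<close>

lemma markov_chain_borel_kernel:
  assumes "markov_chain \<Omega> \<P> X"
  shows "borel_kernel (nstep \<P> X 1)"
  using assms by (simp add: markov_chain_def borel_kernel_def)

text \<open>Chapman-Kolmogorov for the last step: integrating the Markov property removes the
  conditional expectation. The real integral becomes a nonnegative one since its integrand is a
  probability, hence bounded by 1.\<close>

lemma emeasure_nstep_Suc: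
  assumes mc: "markov_chain \<Omega> \<P> X" and B: "B \<in> sets borel"
  shows "emeasure (nstep \<P> X (Suc n) x) B
    = (\<integral>\<^sup>+y. emeasure (nstep \<P> X 1 y) B \<partial>nstep \<P> X n x)"
proof -
  interpret borel_kernel "nstep \<P> X 1"
    using mc by (rule markov_chain_borel_kernel)
  interpret prob_space "\<P> x"
    using mc by (simp add: markov_chain_def)
  have sets_P [measurable_cong]: "sets (\<P> x) = sets \<Omega>"
    using mc by (simp add: markov_chain_def)
  then have space_P: "space (\<P> x) = space \<Omega>"
    by (rule sets_eq_imp_space_eq)
  have X [measurable]: "X k \<in> \<Omega> \<rightarrow>\<^sub>M borel" for k
    using mc by (simp add: markov_chain_def)
  have "sets (natural_filtration \<Omega> X n) \<subseteq> sets \<Omega>"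
    unfolding natural_filtration_def using measurable_sets[OF X]
    by (subst sets_measure_of) (auto intro!: sets.sigma_sets_subset)
  then have "subalgebra (\<P> x) (natural_filtration \<Omega> X n)"
    by (simp add: subalgebra_def sets_P space_P natural_filtration_def space_measure_of_conv)
  then interpret finite_measure_subalgebra "\<P> x" "natural_filtration \<Omega> X n"
    by unfold_locales
  let ?I = "indicator (X (Suc n) -` B \<inter> space \<Omega>) :: _ \<Rightarrow> real"
  have set: "X (Suc n) -` B \<inter> space \<Omega> \<in> sets (\<P> x)"
    using measurable_sets[OF X B, of "Suc n"] by (simp add: sets_P)
  have int: "integrable (\<P> x) ?I"
    using set by (simp add: emeasure_eq_measure)
  have meas [measurable]: "(\<lambda>y. measure (nstep \<P> X 1 y) B) \<in> borel_measurable borel"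
    using kernel B by (intro measurable_compose[OF measurable_prob_algebraD[OF kernel]]
      measurable_measure_subprob_algebra) auto
  have "measure (nstep \<P> X (Suc n) x) B = (\<integral>\<omega>. ?I \<omega> \<partial>\<P> x)"
    using set B by (simp add: nstep_def measure_distr space_P)
  also have "\<dots> = (\<integral>\<omega>. real_cond_exp (\<P> x) (natural_filtration \<Omega> X n) ?I \<omega> \<partial>\<P> x)"
    by (rule real_cond_exp_int(2)[OF int, symmetric])
  also have "\<dots> = (\<integral>\<omega>. measure (nstep \<P> X 1 (X n \<omega>)) B \<partial>\<P> x)"
    using mc B by (intro integral_cong_AE) (auto simp: markov_chain_def)
  finally have eq: "measure (nstep \<P> X (Suc n) x) B = (\<integral>\<omega>. measure (nstep \<P> X 1 (X n \<omega>)) B \<partial>\<P> x)" .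
  have "emeasure (nstep \<P> X (Suc n) x) B = ennreal (measure (nstep \<P> X (Suc n) x) B)"
    by (intro finite_measure.emeasure_eq_measure prob_space.finite_measure)
      (simp add: nstep_def prob_space_distr)
  also have "\<dots> = (\<integral>\<^sup>+\<omega>. ennreal (measure (nstep \<P> X 1 (X n \<omega>)) B) \<partial>\<P> x)"
    unfolding eq
  proof (intro nn_integral_eq_integral[symmetric] integrable_const_bound[of _ 1] AE_I2)
    show "norm (measure (nstep \<P> X 1 (X n \<omega>)) B) \<le> 1" for \<omega>
      using prob_space.prob_le_1[OF prob_space_kernel] by simp
    show "(\<lambda>\<omega>. measure (nstep \<P> X 1 (X n \<omega>)) B) \<in> borel_measurable (\<P> x)"
      by (rule measurable_compose[OF _ meas]) simp
  qed simp
  also have "\<dots> = (\<integral>\<^sup>+y. ennreal (measure (nstep \<P> X 1 y) B) \<partial>nstep \<P> X n x)"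
    unfolding nstep_def[of \<P> X n]
    by (rule nn_integral_distr[symmetric]) (use meas in \<open>simp_all cong: measurable_cong_sets\<close>)
  also have "\<dots> = (\<integral>\<^sup>+y. emeasure (nstep \<P> X 1 y) B \<partial>nstep \<P> X n x)"
    using finite_measure.emeasure_eq_measure[OF prob_space.finite_measure[OF prob_space_kernel]]
    by simp
  finally show ?thesis .
qed

lemma sets_nstep [measurable_cong, simp]: "sets (nstep \<P> X n x) = sets borel"
  by (simp add: nstep_def)

text \<open>Peeling off the last step replaces \<open>f\<close> by its image under the kernel, so
  the induction must leave \<open>f\<close> arbitrary. From here on, statements about the path laws
  reduce to iterates of \<open>kernel_op\<close>.\<close>

lemma nn_integral_nstep:
  assumes mc: "markov_chain \<Omega> \<P> X" and f: "f \<in> borel_measurable borel"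
  shows "(\<integral>\<^sup>+y. f y \<partial>nstep \<P> X n x) = (kernel_op (nstep \<P> X 1) ^^ n) f x"
  using f
proof (induction n arbitrary: f x)
  case 0
  note [measurable] = 0
  interpret prob_space "\<P> x"
    using mc by (simp add: markov_chain_def)
  have [measurable]: "X 0 \<in> \<P> x \<rightarrow>\<^sub>M borel"
    using mc by (simp add: markov_chain_def cong: measurable_cong_sets)
  have "(\<integral>\<^sup>+y. f y \<partial>nstep \<P> X 0 x) = (\<integral>\<^sup>+\<omega>. f (X 0 \<omega>) \<partial>\<P> x)"
    by (simp add: nstep_def nn_integral_distr)
  also have "\<dots> = (\<integral>\<^sup>+\<omega>. f x \<partial>\<P> x)"
    using mc by (intro nn_integral_cong_AE) (auto simp: markov_chain_def elim!: eventually_mono)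
  finally show ?case by (simp add: emeasure_space_1)
next
  case (Suc n)
  interpret borel_kernel "nstep \<P> X 1"
    using mc by (rule markov_chain_borel_kernel)
  have sub: "nstep \<P> X 1 \<in> nstep \<P> X n x \<rightarrow>\<^sub>M subprob_algebra borel"
    using measurable_prob_algebraD[OF kernel] by (simp cong: measurable_cong_sets)
  have ne: "space (nstep \<P> X n x) \<noteq> {}"
    by (simp add: nstep_def)
  have bind: "nstep \<P> X (Suc n) x = nstep \<P> X n x \<bind> nstep \<P> X 1"
  proof (rule measure_eqI)
    show "sets (nstep \<P> X (Suc n) x) = sets (nstep \<P> X n x \<bind> nstep \<P> X 1)"
      using sets_bind[OF _ ne, of "nstep \<P> X 1" borel] by simp
  next
    fix B assume "B \<in> sets (nstep \<P> X (Suc n) x)"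
    then have "B \<in> sets borel" by simp
    then show "emeasure (nstep \<P> X (Suc n) x) B
        = emeasure (nstep \<P> X n x \<bind> nstep \<P> X 1) B"
      by (simp only: emeasure_bind[OF ne sub] emeasure_nstep_Suc[OF mc])
  qed
  have "(\<integral>\<^sup>+y. f y \<partial>nstep \<P> X (Suc n) x)
      = (\<integral>\<^sup>+y. kernel_op (nstep \<P> X 1) f y \<partial>nstep \<P> X n x)"
    unfolding bind kernel_op_def using Suc.prems sub by (intro nn_integral_bind)
  also have "\<dots> = (kernel_op (nstep \<P> X 1) ^^ n) (kernel_op (nstep \<P> X 1) f) x"
    by (intro Suc.IH measurable_kernel_op Suc.prems)
  finally show ?case by (simp add: funpow_swap1)
qed

lemma emeasure_nstep:
  assumes "markov_chain \<Omega> \<P> X" "B \<in> sets borel"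
  shows "emeasure (nstep \<P> X n x) B = (kernel_op (nstep \<P> X 1) ^^ n) (indicator B) x"
  using nn_integral_nstep[OF assms(1), of "indicator B" n x] assms(2) by simp

lemma emeasure_nstep_le_1:
  assumes "markov_chain \<Omega> \<P> X"
  shows "emeasure (nstep \<P> X n x) B \<le> 1"
proof -
  have "prob_space (\<P> x)" "X n \<in> \<P> x \<rightarrow>\<^sub>M borel"
    using assms by (simp_all add: markov_chain_def cong: measurable_cong_sets)
  then have "prob_space (nstep \<P> X n x)"
    by (simp add: nstep_def prob_space.prob_space_distr)
  then show ?thesis
    by (intro subprob_space.subprob_emeasure_le_1 prob_space_imp_subprob_space)
qed

section \<open>Strong ergodicity bounds the mean hitting time\<close>

text \<open>The minorizing measure charges a set \<open>D\<close> from which \<open>A\<close> is hit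
  at one fixed time with probability bounded below. Minorization leads from \<open>C\<close> to
  \<open>D\<close> within boundedly many steps, and the two passages are concatenated.\<close>

lemma petite_survival:
  fixes \<P> :: "'a::topological_space \<Rightarrow> 'w measure"
  assumes mc: "markov_chain \<Omega> \<P> X" and irr: "irreducibility_measure \<P> X \<psi>"
    and A: "A \<in> positive_sets \<psi>" and C: "petite \<P> X C"
  obtains N \<delta> where "\<delta> > 0" "\<And>x. x \<in> C \<Longrightarrow> \<delta> + survival (nstep \<P> X 1) A N x \<le> 1"
proof -
  interpret borel_kernel "nstep \<P> X 1"
    using mc by (rule markov_chain_borel_kernel)
  let ?P = "\<lambda>n B y. emeasure (nstep \<P> X n y) B"
  let ?g = "survival (nstep \<P> X 1) A"
  have A_meas [measurable]: "A \<in> sets borel"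
    using A by (simp add: positive_sets_def)
  obtain a :: "nat pmf" and \<nu> where \<nu>: "sets \<nu> = sets borel" "emeasure \<nu> UNIV > 0"
    and minor: "\<And>x B. x \<in> C \<Longrightarrow> B \<in> sets borel \<Longrightarrow>
      emeasure \<nu> B \<le> (\<Sum>n. ennreal (pmf a n) * ?P n B x)"
    using C unfolding petite_def by blast
  \<comment> \<open>Irreducibility makes these countably many sets cover the space, so one of them
    has positive \<nu>-measure.\<close>
  define B where "B = (\<lambda>(n, j). {y. ennreal (inverse (real (Suc j))) \<le> ?P (Suc n) A y})"
  have P_meas: "?P n D \<in> borel_measurable borel" if "D \<in> sets borel" for n D
    unfolding emeasure_nstep[OF mc that]
    by (intro measurable_kernel_op_funpow borel_measurable_indicator that)
  have B_meas [measurable]: "B p \<in> sets borel" for p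
    using measurable_sets[OF P_meas[OF A_meas, of "Suc (fst p)"],
        of "{ennreal (inverse (real (Suc (snd p))))..}"]
    by (simp add: B_def vimage_def case_prod_beta)
  have "(\<Union>p. B p) = UNIV"
  proof (intro equalityI subsetI UNIV_I)
    fix y :: 'a
    have "(\<Sum>n. ?P (Suc n) A y) > 0"
      using irr A by (auto simp: irreducibility_measure_def positive_sets_def)
    then obtain n where n: "?P (Suc n) A y \<noteq> 0"
      by (cases "\<forall>n. ?P (Suc n) A y = 0") auto
    have "?P (Suc n) A y < \<top>"
      using emeasure_nstep_le_1[OF mc, of "Suc n" y A] by (rule le_less_trans) simp
    then obtain p where p: "?P (Suc n) A y = ennreal p" "0 \<le> p"
      by (auto simp: less_top_ennreal)
    then have "0 < p"
      using n by (cases "p = 0") auto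
    then obtain j where "inverse (real (Suc j)) < p"
      using reals_Archimedean by blast
    then have "ennreal (inverse (real (Suc j))) < ?P (Suc n) A y"
      unfolding p(1) by (intro ennreal_lessI \<open>0 < p\<close>)
    then have "y \<in> B (n, j)" by (simp add: B_def less_imp_le)
    then show "y \<in> (\<Union>p. B p)" by blast
  qed
  have "\<exists>p. emeasure \<nu> (B p) > 0"
  proof (rule ccontr)
    assume "\<not> ?thesis"
    then have "B p \<in> null_sets \<nu>" for p
      using \<nu>(1) by (cases p) (auto simp: null_sets_def)
    then have "(\<Union>p. B p) \<in> null_sets \<nu>"
      by (intro null_sets_UN)
    then show False
      using \<open>(\<Union>p. B p) = UNIV\<close> \<nu>(2) by auto
  qed
  then obtain n j where pos: "emeasure \<nu> (B (n, j)) > 0"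
    by auto
  define D where "D = B (n, j)"
  have D [measurable]: "D \<in> sets borel" by (simp add: D_def)
  \<comment> \<open>The infinite case has to be treated, since minorization does not bound \<nu>
    when \<open>C\<close> is empty.\<close>
  obtain r where r: "0 < r" "ennreal r \<le> emeasure \<nu> D"
  proof (cases "emeasure \<nu> D")
    case (real r)
    then show ?thesis using that[of r] pos by (cases "r = 0") (auto simp: D_def)
  next
    case top
    then show ?thesis using that[of 1] by simp
  qed
  \<comment> \<open>One half of \<open>r\<close> absorbs the tail of the sampling distribution, the
    other half is the threshold for the times below \<open>N\<close>.\<close>
  define \<eta> where "\<eta> = ennreal (r / 2)"
  have \<eta>: "0 < \<eta>" "\<eta> < \<top>" "\<eta> + \<eta> \<le> emeasure \<nu> D"
    using r by (auto simp: \<eta>_def ennreal_plus[symmetric] simp del: ennreal_plus)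
  have total: "(\<Sum>k. ennreal (pmf a k)) = 1"
    by (simp add: nn_integral_count_space_nat[symmetric] nn_integral_pmf)
  then have summable: "summable (pmf a)"
    by (intro summable_suminf_not_top) auto
  obtain N where "norm (\<Sum>k. pmf a (k + N)) < r / 2"
    using suminf_exist_split[OF _ summable, of "r / 2"] r(1) by auto
  then have N: "(\<Sum>k. ennreal (pmf a (k + N))) < \<eta>"
    using summable summable_ignore_initial_segment[OF summable, of N] r(1)
    by (subst suminf_ennreal2) (auto simp: \<eta>_def intro!: ennreal_lessI)
  \<comment> \<open>Otherwise the terms below \<open>N\<close> contribute at most \<eta> and the
    tail strictly less than \<eta>, contradicting minorization on \<open>D\<close>.\<close>
  have hit: "\<exists>k<N. \<eta> \<le> ?P k D x" if "x \<in> C" for x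
  proof (rule ccontr)
    assume "\<not> ?thesis"
    then have small: "?P k D x \<le> \<eta>" if "k < N" for k
      using that by (meson less_imp_le not_le)
    have "\<eta> + \<eta> \<le> (\<Sum>k. ennreal (pmf a k) * ?P k D x)"
      using \<eta>(3) minor[OF \<open>x \<in> C\<close> D] by (rule order_trans)
    also have "\<dots> = (\<Sum>k. ennreal (pmf a (k + N)) * ?P (k + N) D x)
        + (\<Sum>k<N. ennreal (pmf a k) * ?P k D x)"
      by (subst suminf_offset[of _ N]) (simp_all add: add.commute)
    also have "\<dots> \<le> (\<Sum>k. ennreal (pmf a (k + N)) * 1) + (\<Sum>k<N. ennreal (pmf a k) * \<eta>)"
      using small emeasure_nstep_le_1[OF mc]
      by (intro add_mono suminf_le sum_mono mult_left_mono) auto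
    also have "\<dots> < \<eta> + \<eta>"
    proof -
      have "(\<Sum>k<N. ennreal (pmf a k)) \<le> 1"
        unfolding total[symmetric] by (intro sum_le_suminf) auto
      then have "(\<Sum>k<N. ennreal (pmf a k) * \<eta>) \<le> \<eta>"
        unfolding sum_distrib_right[symmetric]
        using mult_right_mono[of "\<Sum>k<N. ennreal (pmf a k)" 1 \<eta>] by simp
      then have "(\<Sum>k. ennreal (pmf a (k + N)) * 1) + (\<Sum>k<N. ennreal (pmf a k) * \<eta>)
          \<le> (\<Sum>k. ennreal (pmf a (k + N))) + \<eta>"
        by (simp add: add_left_mono)
      also have "\<dots> < \<eta> + \<eta>"
        unfolding add.commute[of "\<Sum>k. ennreal (pmf a (k + N))"]
        unfolding ennreal_add_left_cancel_less infinity_ennreal_def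
        using N less_imp_neq[OF \<eta>(2)] by (rule conjI[rotated])
      finally show ?thesis .
    qed
    finally show False by simp
  qed
  have surv_D: "ennreal (inverse (real (Suc j))) + ?g (Suc n) y \<le> 1" if "y \<in> D" for y
  proof -
    have "ennreal (inverse (real (Suc j))) \<le> ?P (Suc n) A y"
      using that by (simp add: D_def B_def)
    then have "ennreal (inverse (real (Suc j))) + ?g (Suc n) y \<le> ?P (Suc n) A y + ?g (Suc n) y"
      by (rule add_right_mono)
    also have "\<dots> \<le> 1"
      unfolding emeasure_nstep[OF mc A_meas]
      by (rule funpow_indicator_add_survival_le_1[OF A_meas])
    finally show ?thesis .
  qed
  show ?thesis
  proof (rule that)
    show "0 < ennreal (inverse (real (Suc j))) * \<eta>"
      unfolding ennreal_zero_less_mult_iff using \<eta>(1) by simp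
    fix x assume "x \<in> C"
    then obtain k where k: "k < N" "\<eta> \<le> ?P k D x"
      using hit by blast
    have "ennreal (inverse (real (Suc j))) * ?P k D x + ?g (Suc n + N) x \<le> 1"
      unfolding emeasure_nstep[OF mc D]
      using k(1) by (intro survival_le_1_via_set[OF A_meas D surv_D]) simp_all
    then show "ennreal (inverse (real (Suc j))) * \<eta> + ?g (Suc n + N) x \<le> 1"
      using order_trans[OF add_right_mono[OF mult_left_mono[OF k(2) zero_le]]] by blast
  qed
qed

text \<open>If \<open>C\<close> were unlikely at each time up to \<open>L\<close>, a union bound
  would make the return time exceed \<open>L\<close> with probability close to 1, forcing its mean
  above the supposed bound.\<close>

lemma return_time_hit:
  fixes \<P> :: "'a::topological_space \<Rightarrow> 'w measure"
  assumes mc: "markov_chain \<Omega> \<P> X" and C: "C \<in> sets borel"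
    and fin: "(SUP x. \<integral>\<^sup>+\<omega>. ennreal_of_enat (return_time X C \<omega>) \<partial>\<P> x) < \<infinity>"
  obtains L \<kappa> where "\<kappa> > 0" "\<And>x. \<exists>k\<le>L. \<kappa> \<le> emeasure (nstep \<P> X k x) C"
proof -
  define M where "M = (SUP x. \<integral>\<^sup>+\<omega>. ennreal_of_enat (return_time X C \<omega>) \<partial>\<P> x)"
  obtain L :: nat where L: "M < of_nat L"
    using fin ennreal_Ex_less_of_nat[of M] by (auto simp: M_def)
  show ?thesis
  proof (rule that)
    \<comment> \<open>With \<kappa> = 1/(L+1)^2 the union bound over times 1 to \<open>L\<close> is
      at most 1/(L+1), so \<open>C\<close> is avoided with probability at least L/(L+1). There the
      return time is at least L+1, which makes its mean at least \<open>L\<close>.\<close>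
    show "0 < ennreal (inverse (real (Suc L)) / real (Suc L))"
      by simp
    fix x
    let ?\<kappa> = "inverse (real (Suc L)) / real (Suc L)"
    show "\<exists>k\<le>L. ennreal ?\<kappa> \<le> emeasure (nstep \<P> X k x) C"
    proof (rule ccontr)
      assume "\<not> ?thesis"
      then have small: "emeasure (nstep \<P> X k x) C < ennreal ?\<kappa>" if "k \<le> L" for k
        using that not_le by blast
      interpret prob_space "\<P> x"
        using mc by (simp add: markov_chain_def)
      have X: "X k \<in> \<P> x \<rightarrow>\<^sub>M borel" for k
        using mc by (simp add: markov_chain_def cong: measurable_cong_sets)
      define H where "H k = X k -` C \<inter> space (\<P> x)" for k
      have H [measurable]: "H k \<in> sets (\<P> x)" for k
        unfolding H_def using measurable_sets[OF X C] .
      have H_prob: "prob (H k) \<le> ?\<kappa>" if "k \<le> L" for k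
        using small[OF that] emeasure_distr[OF X C, of k]
        by (simp add: nstep_def H_def emeasure_eq_measure ennreal_less_iff)
      define U where "U = (\<Union>k\<in>{1..L}. H k)"
      have U [measurable]: "U \<in> sets (\<P> x)"
        unfolding U_def by measurable
      have "prob U \<le> (\<Sum>k\<in>{1..L}. prob (H k))"
        unfolding U_def by (intro finite_measure_subadditive_finite) auto
      also have "\<dots> \<le> (\<Sum>k\<in>{1..L}. ?\<kappa>)"
        by (intro sum_mono H_prob) simp
      also have "\<dots> = real L / real (Suc L) * inverse (real (Suc L))"
        by simp
      also have "\<dots> \<le> 1 * inverse (real (Suc L))"
        by (intro mult_right_mono) auto
      finally have "real L / real (Suc L) \<le> prob (space (\<P> x) - U)"
        unfolding prob_compl[OF U] by (simp add: field_simps)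
      then have "ennreal (real L) \<le> of_nat (Suc L) * emeasure (\<P> x) (space (\<P> x) - U)"
        by (simp add: emeasure_eq_measure ennreal_of_nat_eq_real_of_nat ennreal_mult[symmetric]
            field_simps del: of_nat_Suc)
      also have "\<dots> = (\<integral>\<^sup>+\<omega>. of_nat (Suc L) * indicator (space (\<P> x) - U) \<omega> \<partial>\<P> x)"
        by (subst nn_integral_cmult_indicator) auto
      also have "\<dots> \<le> (\<integral>\<^sup>+\<omega>. ennreal_of_enat (return_time X C \<omega>) \<partial>\<P> x)"
      proof (intro nn_integral_mono)
        fix \<omega> assume "\<omega> \<in> space (\<P> x)"
        have le: "enat (Suc L) \<le> return_time X C \<omega>" if "\<omega> \<notin> U"
          unfolding return_time_def
        proof (intro INF_greatest)
          fix n assume "n \<in> {n. 1 \<le> n \<and> X n \<omega> \<in> C}"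
          then show "enat (Suc L) \<le> enat n"
            using that \<open>\<omega> \<in> space (\<P> x)\<close> by (force simp: U_def H_def not_le)
        qed
        have "ennreal_of_enat (enat (Suc L)) \<le> ennreal_of_enat (return_time X C \<omega>)" if "\<omega> \<notin> U"
          unfolding ennreal_of_enat_le_iff using that by (rule le)
        then show "of_nat (Suc L) * indicator (space (\<P> x) - U) \<omega>
            \<le> ennreal_of_enat (return_time X C \<omega>)"
          by (auto simp: indicator_def)
      qed
      also have "\<dots> \<le> M"
        unfolding M_def by (intro SUP_upper) simp
      finally show False
        using L by (simp add: ennreal_of_nat_eq_real_of_nat)
    qed
  qed
qed

text \<open>By the tail-sum formula the series is the expected hitting time of \<open>A\<close> at
  positive times. From any point, \<open>C\<close> and then \<open>A\<close> are reached within
  \<open>N + L\<close> steps with chance at least \<delta>\<kappa>, so the block estimate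
  applies.\<close>

lemma strongly_ergodic_suminf_survival:
  fixes \<P> :: "'a::topological_space \<Rightarrow> 'w measure"
  assumes mc: "markov_chain \<Omega> \<P> X" and irr: "irreducibility_measure \<P> X \<psi>"
    and A: "A \<in> positive_sets \<psi>" and erg: "strongly_ergodic \<P> X"
  obtains M where "0 \<le> M" "\<And>x. (\<Sum>n. survival (nstep \<P> X 1) A n x) \<le> ennreal M"
proof -
  interpret borel_kernel "nstep \<P> X 1"
    using mc by (rule markov_chain_borel_kernel)
  let ?g = "survival (nstep \<P> X 1) A"
  have A_meas: "A \<in> sets borel"
    using A by (simp add: positive_sets_def)
  obtain C where C: "petite \<P> X C"
    and fin: "(SUP x. \<integral>\<^sup>+\<omega>. ennreal_of_enat (return_time X C \<omega>) \<partial>\<P> x) < \<infinity>"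
    using erg by (auto simp: strongly_ergodic_def)
  have C_meas: "C \<in> sets borel"
    using C by (simp add: petite_def)
  obtain N \<delta> where \<delta>: "\<delta> > 0" "\<And>x. x \<in> C \<Longrightarrow> \<delta> + ?g N x \<le> 1"
    by (rule petite_survival[OF mc irr A C]) (rule that)
  obtain L \<kappa> where \<kappa>: "\<kappa> > 0" "\<And>x. \<exists>k\<le>L. \<kappa> \<le> emeasure (nstep \<P> X k x) C"
    by (rule return_time_hit[OF mc C_meas fin]) (rule that)
  have bound: "\<delta> * \<kappa> + ?g (N + L) x \<le> 1" for x
  proof -
    obtain k where k: "k \<le> L" "\<kappa> \<le> emeasure (nstep \<P> X k x) C"
      using \<kappa>(2) by blast
    have "\<delta> * emeasure (nstep \<P> X k x) C + ?g (N + L) x \<le> 1"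
      unfolding emeasure_nstep[OF mc C_meas]
      using A_meas C_meas \<delta>(2) k(1) by (rule survival_le_1_via_set)
    then show ?thesis
      using k(2) by (meson add_right_mono mult_left_mono order_trans zero_le)
  qed
  then have le: "\<delta> * \<kappa> * (\<Sum>n. ?g n x) \<le> of_nat (N + L)" for x
    by (rule suminf_survival_le[OF A_meas])
  have pos: "\<delta> * \<kappa> > 0"
    using \<delta>(1) \<kappa>(1) by (simp add: ennreal_zero_less_mult_iff)
  have fin: "\<delta> * \<kappa> \<noteq> \<top>"
    using bound[of undefined] by (auto simp: top_unique)
  have "(\<Sum>n. ?g n x) \<le> of_nat (N + L) / (\<delta> * \<kappa>)" for x
  proof -
    have "(\<Sum>n. ?g n x) = \<delta> * \<kappa> * (\<Sum>n. ?g n x) / (\<delta> * \<kappa>)"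
      unfolding mult.commute[of "\<delta> * \<kappa>"]
      by (rule ennreal_mult_divide_eq[symmetric]) (use pos fin in auto)
    also have "\<dots> \<le> of_nat (N + L) / (\<delta> * \<kappa>)"
      by (intro divide_right_mono_ennreal le)
    finally show ?thesis .
  qed
  moreover have "of_nat (N + L) / (\<delta> * \<kappa>) \<noteq> \<top>"
    using pos by (auto simp: ennreal_divide_eq_top_iff)
  ultimately show ?thesis
    using that[of "enn2real (of_nat (N + L) / (\<delta> * \<kappa>))"]
    by (simp add: less_top)
qed

section \<open>Contradiction with the unboundedness of \<open>V\<close> off \<open>A\<close>\<close>

theorem proposition1p6:
  fixes \<Omega> :: "'w measure"
    and \<P> :: "'a::{metric_space, second_countable_topology} \<Rightarrow> 'w measure"
    and X :: "nat \<Rightarrow> 'w \<Rightarrow> 'a"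
    and \<psi> :: "'a measure"
    and E :: "nat \<Rightarrow> 'a set"
    and V W :: "'a \<Rightarrow> real"
    and A :: "'a set"
    and d :: real
  assumes "locally compact (UNIV :: 'a set)"
    and "markov_chain \<Omega> \<P> X"
    and "maximal_irreducibility_measure \<P> X \<psi>"
    and "harris_recurrent \<P> X \<psi>"
    and "\<And>n. n \<ge> 1 \<Longrightarrow> E n \<in> sets borel \<and> bounded (E n)"
    and "\<And>m n. 1 \<le> m \<Longrightarrow> m \<le> n \<Longrightarrow> E m \<subseteq> E n"
    and "(\<Union>n\<in>{1..}. E n) = UNIV"
    and "continuous_on UNIV V"
    and "A \<in> positive_sets \<psi>"
    and "continuous_on UNIV W"
    and "\<And>x. W x \<ge> 0"
    and "(SUP x\<in>A. ereal (V x)) < \<infinity>"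
    and "(SUP x\<in>-A. ereal (V x)) = \<infinity>"
    and "locally_bounded V"
    and "\<And>x. x \<in> -A \<Longrightarrow>
           integrable (nstep \<P> X 1 x) V \<and> (\<integral>y. V y \<partial>nstep \<P> X 1 x) \<ge> V x - 1"
    and "\<And>x. integrable (nstep \<P> X 1 x) W \<and>
           (\<integral>y. W y \<partial>nstep \<P> X 1 x) \<le> W x + d * indicator A x"
    and "(\<lambda>m. SUP x\<in>-E m. ereal (V x) / ereal (W x)) \<longlonglongrightarrow> 0"
  shows "\<not> strongly_ergodic \<P> X"
proof
  assume erg: "strongly_ergodic \<P> X"
  note E = assms(5) and V_cont = assms(8) and A = assms(9)
    and W_cont = assms(10) and W_nonneg = assms(11) and V_bdd_A = assms(12)
    and V_unbdd = assms(13) and V_loc = assms(14) and V_drift = assms(15)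
    and W_drift = assms(16) and ratio = assms(17)
  have irr: "irreducibility_measure \<P> X \<psi>"
    using assms(3) by (simp add: maximal_irreducibility_measure_def)
  interpret borel_kernel "nstep \<P> X 1"
    using assms(2) by (rule markov_chain_borel_kernel)
  note [simp del] = One_nat_def
  let ?K = "nstep \<P> X 1"
  have A_meas: "A \<in> sets borel"
    using A by (simp add: positive_sets_def)
  have [measurable]: "V \<in> borel_measurable borel" "W \<in> borel_measurable borel"
    using V_cont W_cont by (simp_all add: borel_measurable_continuous_onI)
  obtain M where M: "0 \<le> M" "\<And>x. (\<Sum>n. survival ?K A n x) \<le> ennreal M"
    by (rule strongly_ergodic_suminf_survival[OF assms(2) irr A erg]) (rule that)
  obtain c where c: "\<And>x. x \<in> A \<Longrightarrow> V x \<le> c"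
  proof -
    obtain c where "(SUP x\<in>A. ereal (V x)) \<le> ereal c"
      using V_bdd_A by (cases "SUP x\<in>A. ereal (V x)") auto
    then show ?thesis
      using that[of c] by (simp add: SUP_le_iff)
  qed
  \<comment> \<open>Outside a suitable \<open>E m\<close> the ratio condition gives
    \<open>V \<le> \<epsilon> W\<close>; on the bounded set \<open>E m\<close>, \<open>V\<close> is
    bounded by a constant.\<close>
  have dominated: "\<exists>b. \<forall>y. V y \<le> b + \<epsilon> * W y" if "\<epsilon> > 0" for \<epsilon>
  proof -
    have "eventually (\<lambda>m. (SUP x\<in>-E m. ereal (V x) / ereal (W x)) < ereal \<epsilon>) sequentially"
      using ratio \<open>\<epsilon> > 0\<close> by (intro order_tendstoD) auto
    then obtain m where m: "m \<ge> 1" "(SUP x\<in>-E m. ereal (V x) / ereal (W x)) < ereal \<epsilon>"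
      using eventually_conj[OF eventually_ge_at_top[of 1]] eventually_happens'[OF sequentially_bot]
      by blast
    have "bounded (V ` E m)"
      using E[OF m(1)] V_loc by (simp add: locally_bounded_def)
    then obtain b where b: "\<And>y. y \<in> E m \<Longrightarrow> \<bar>V y\<bar> \<le> b"
      by (auto simp: bounded_iff)
    have "V y \<le> \<bar>b\<bar> + \<epsilon> * W y" for y
    proof (cases "y \<in> E m")
      case True
      have "0 \<le> \<epsilon> * W y"
        using \<open>\<epsilon> > 0\<close> W_nonneg by simp
      then show ?thesis
        using b[OF True] by linarith
    next
      case False
      then have less: "ereal (V y) / ereal (W y) < ereal \<epsilon>"
        using m(2) by (meson ComplI SUP_upper le_less_trans)
      have "V y \<le> \<epsilon> * W y"
      \<comment> \<open>In \<open>ereal\<close> a positive number divided by 0 is \<infinity>, so at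
        zeros of \<open>W\<close> a quotient below \<epsilon> forces
        \<open>V y \<le> 0\<close>.\<close>
      proof (cases "W y = 0")
        case True
        then show ?thesis
          using less by (cases "V y > 0") auto
      next
        case False
        then have "W y > 0"
          using W_nonneg[of y] by simp
        then show ?thesis
          using less by (simp add: field_simps)
      qed
      then show ?thesis by simp
    qed
    then show ?thesis by blast
  qed
  have bound: "V x \<le> c + M + \<epsilon> * W x" if x: "x \<notin> A" and \<epsilon>: "\<epsilon> > 0" for x \<epsilon>
  proof -
    obtain b0 where b0: "\<And>y. V y \<le> b0 + \<epsilon> * W y"
      using dominated[OF \<epsilon>] by blast
    \<comment> \<open>\<open>b0\<close> makes \<open>h\<close> nonnegative, and \<open>c\<close>
      keeps \<open>b - c\<close> nonnegative, so neither is truncated by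
      \<open>ennreal\<close>.\<close>
    define b where "b = max b0 c"
    define h where "h y = b + \<epsilon> * W y - V y" for y
    have h_nonneg: "0 \<le> h y" for y
      using b0[of y] by (simp add: h_def b_def)
    have [measurable]: "h \<in> borel_measurable borel"
      unfolding h_def by measurable
    have "ennreal (b - c) \<le> ennreal (h x) + (\<Sum>k. survival ?K A k x)"
    proof (rule drift_lower_bound_suminf[OF A_meas _ _ _ x])
      show "(\<lambda>y. ennreal (h y)) \<in> borel_measurable borel"
        by measurable
      show "ennreal (b - c) \<le> ennreal (h y)" if "y \<in> A" for y
      proof -
        have "0 \<le> \<epsilon> * W y"
          using W_nonneg \<epsilon> by simp
        then show ?thesis
          using c[OF that] by (intro ennreal_leI) (simp add: h_def)
      qed
      \<comment> \<open>Off \<open>A\<close> the term with \<open>d\<close> vanishes, so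
        \<open>W\<close> does not increase in mean while \<open>V\<close> loses at most 1.\<close>
      show "kernel_op ?K (\<lambda>y. ennreal (h y)) y \<le> ennreal (h y) + 1" if "y \<notin> A" for y
      proof -
        interpret K: prob_space "?K y"
          by (rule prob_space_kernel)
        have int: "integrable (?K y) V" "integrable (?K y) W"
          using V_drift[of y] W_drift[of y] that by auto
        have "kernel_op ?K (\<lambda>y. ennreal (h y)) y = ennreal (\<integral>z. h z \<partial>?K y)"
          unfolding kernel_op_def using int h_nonneg
          by (intro nn_integral_eq_integral) (auto simp: h_def)
        also have "(\<integral>z. h z \<partial>?K y) = b + \<epsilon> * (\<integral>z. W z \<partial>?K y) - (\<integral>z. V z \<partial>?K y)"
          unfolding h_def using int K.prob_space by simp
        also have "\<dots> \<le> b + \<epsilon> * W y - (V y - 1)"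
        proof -
          have "\<epsilon> * (\<integral>z. W z \<partial>?K y) \<le> \<epsilon> * W y"
            using W_drift[of y] that \<epsilon> by (intro mult_left_mono) auto
          moreover have "V y - 1 \<le> (\<integral>z. V z \<partial>?K y)"
            using V_drift[of y] that by simp
          ultimately show ?thesis by linarith
        qed
        also have "\<dots> = h y + 1" by (simp add: h_def)
        finally show ?thesis
          using h_nonneg[of y] by (simp add: ennreal_leI)
      qed
      show "(\<Sum>k. survival ?K A k x) < \<top>"
        using M(2)[of x] by (rule le_less_trans) simp
    qed simp
    also have "\<dots> \<le> ennreal (h x) + ennreal M"
      using M(2) by (rule add_left_mono)
    finally have "b - c \<le> h x + M"
      using h_nonneg[of x] M(1) by (simp flip: ennreal_plus)
    \<comment> \<open>The constant \<open>b\<close>, which depends on \<epsilon>, cancels; only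
      \<open>c\<close> and \<open>M\<close> remain.\<close>
    then show ?thesis by (simp add: h_def)
  qed
  have "V x \<le> c + M" if "x \<notin> A" for x
  proof (rule field_le_epsilon)
    fix e :: real assume "e > 0"
    \<comment> \<open>Here \<epsilon> is chosen for the fixed point \<open>x\<close>; adding 1 to
      \<open>W x\<close> keeps the denominator positive.\<close>
    have "V x \<le> c + M + e / (W x + 1) * W x"
      using W_nonneg[of x] \<open>e > 0\<close> by (intro bound that) (simp add: add_nonneg_pos)
    also have "e / (W x + 1) * W x \<le> e"
      using W_nonneg[of x] \<open>e > 0\<close> by (simp add: field_simps)
    finally show "V x \<le> c + M + e" by simp
  qed
  then have "(SUP x\<in>-A. ereal (V x)) \<le> ereal (c + M)"
    by (intro SUP_least) simp
  with V_unbdd show False by simp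
qed

end
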